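(* For all $k\ge1$ and $n\ge0$, $F_k(n)=\sum_{p\in D_k(n)}A_{k,p\ominus1}$. More generally, for all $1\le q\le k$, $F_k^q(n)=\sum_{p\in D_k(n)}A_{k,p\ominus q}$.
   Context: For $k\ge1$, $F_k:\mathbb{N}\to\mathbb{N}$ is defined by $F_k(0)=0$ and $F_k(n)=n-F_k^k(n-1)$ for $n\ge1$, where $F_k^j$ denotes the $j$-th iterate of $F_k$. The sequence $(A_{k,p})_{p\ge0}$ is defined by $A_{k,p}=p+1$ for $0\le p<k$ and $A_{k,p}=A_{k,p-1}+A_{k,p-k}$ for $p\ge k$. For $a,b\in\mathbb{N}$, $a\ominus b=\max(0,a-b)$. For $n\ge0$, $D_k(n)$ denotes the unique finite set $D\subset\mathbb{N}$ whose elements are pairwise at distance at least $k$ and such that $\sum_{p\in D}A_{k,p}=n$ (its existence and uniqueness is a generalized Zeckendorf theorem). *)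

theory Defs
  imports Main
begin

lemma funpow_fundef_cong [fundef_cong]:
  assumes "k = l" "x = y" "\<And>z. f z = g z"
  shows "(f ^^ k) x = (g ^^ l) y"
  using assms by presburger

text \<open>The guard \<open>m \<le> n\<close> only makes the nested recursion visibly terminating. It always holds
  on the iterates concerned, and the lemmas \<open>hof_F_0\<close> and \<open>hof_F_rec\<close> below are the intended
  recursion, which determines the function.\<close>

function hof_F :: "nat \<Rightarrow> nat \<Rightarrow> nat" where
  "hof_F k 0 = 0"
| "hof_F k (Suc n) = Suc n - ((\<lambda>m. if m \<le> n then hof_F k m else 0) ^^ k) n"
  by pat_completeness auto
termination by (relation "measure snd") auto

lemma hof_F_le: "hof_F k n \<le> n"
  by (cases n) auto

lemma hof_F_funpow_le: "(hof_F k ^^ j) n \<le> n"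
  by (induction j) (auto intro: le_trans[OF hof_F_le])

lemma hof_F_0: "hof_F k 0 = 0"
  by simp

lemma hof_F_rec:
  assumes "n \<ge> 1"
  shows "hof_F k n = n - (hof_F k ^^ k) (n - 1)"
proof -
  obtain m where n: "n = Suc m"
    using assms by (cases n) auto
  have "((\<lambda>i. if i \<le> m then hof_F k i else 0) ^^ j) m = (hof_F k ^^ j) m" for j
    by (induction j) (auto simp: hof_F_funpow_le)
  then show ?thesis
    by (simp add: n)
qed

declare hof_F.simps(2) [simp del]

text \<open>The recursion is meant for \<open>k \<ge> 1\<close>; the disjunct \<open>k = 0\<close> only makes the function total.\<close>

function seq_A :: "nat \<Rightarrow> nat \<Rightarrow> nat" where
  "seq_A k p = (if k = 0 \<or> p < k then p + 1 else seq_A k (p - 1) + seq_A k (p - k))"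
  by pat_completeness auto
termination by (relation "measure snd") auto

declare seq_A.simps [simp del]

definition is_decomp :: "nat \<Rightarrow> nat \<Rightarrow> nat set \<Rightarrow> bool" where
  "is_decomp k n D \<longleftrightarrow>
     finite D \<and> (\<forall>p\<in>D. \<forall>q\<in>D. p \<noteq> q \<longrightarrow> \<bar>int p - int q\<bar> \<ge> int k) \<and> (\<Sum>p\<in>D. seq_A k p) = n"

definition decomp :: "nat \<Rightarrow> nat \<Rightarrow> nat set" where
  "decomp k n = (THE D. is_decomp k n D)"

end

theory Submission
  imports Defs
begin

text \<open>Let \<open>f n\<close> be the sum of the \<open>A (p - 1)\<close> over \<open>p \<in> D n\<close>. With truncated subtraction,
  \<open>A p = A (p - 1) + A (p - k)\<close> holds for all \<open>p \<ge> 1\<close>, and every \<open>n > 0\<close> is \<open>A p + m\<close> with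
  \<open>m < A (p + 1 - k)\<close>, in which case \<open>D n = {p} \<union> D m\<close>. Induction along this splitting gives
  \<open>f ^^ q\<close> as the shift by \<open>q \<le> k\<close>. The point is that \<open>f (A p + m) = A (p - 1) + f m\<close> survives in
  the boundary case \<open>m = A (p + 1 - k)\<close> if \<open>p \<ge> 1\<close>, which absorbs the carries that appear when a
  shifted decomposition is no longer sparse. The same induction shows that the shifts by \<open>1\<close> and
  \<open>k\<close> satisfy the recursion defining \<open>hof_F\<close>.\<close>

section \<open>The numbers \<open>A\<close>: recursion, growth and greedy splitting\<close>

lemma seq_A_0 [simp]: "seq_A k 0 = 1"
  by (subst seq_A.simps) auto

lemma seq_A_small: "p < k \<Longrightarrow> seq_A k p = p + 1"
  by (simp add: seq_A.simps)

text \<open>For \<open>p < k\<close> the term \<open>A (p - k)\<close> is \<open>A 0 = 1\<close>,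
  exactly the step between consecutive initial values.\<close>

lemma seq_A_rec:
  assumes "k \<ge> 1" "p \<ge> 1"
  shows "seq_A k p = seq_A k (p - 1) + seq_A k (p - k)"
proof (cases "p < k")
  case True
  then show ?thesis using assms by (simp add: seq_A_small)
next
  case False
  then show ?thesis using assms by (subst seq_A.simps) simp
qed

lemma seq_A_Suc:
  assumes "k \<ge> 1"
  shows "seq_A k (Suc p) = seq_A k p + seq_A k (Suc p - k)"
  using seq_A_rec[OF assms, of "Suc p"] by simp

lemma seq_A_pos: "seq_A k p > 0"
  by (induction k p rule: seq_A.induct) (subst seq_A.simps, auto)

lemma strict_mono_seq_A:
  assumes "k \<ge> 1"
  shows "strict_mono (seq_A k)"
  by (simp add: strict_mono_Suc_iff seq_A_Suc[OF assms] seq_A_pos)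

lemma seq_A_less_iff: "k \<ge> 1 \<Longrightarrow> seq_A k p < seq_A k q \<longleftrightarrow> p < q"
  by (simp add: strict_mono_less strict_mono_seq_A)

lemma seq_A_le_iff: "k \<ge> 1 \<Longrightarrow> seq_A k p \<le> seq_A k q \<longleftrightarrow> p \<le> q"
  by (simp add: strict_mono_less_eq strict_mono_seq_A)

text \<open>Greedy choice: \<open>p\<close> is the last index with \<open>A p \<le> n\<close>, so
  the remainder stays below the gap \<open>A (p + 1) - A p = A (p + 1 - k)\<close>.\<close>

lemma seq_A_split:
  assumes "k \<ge> 1" "n > 0"
  obtains p m where "n = seq_A k p + m" "m < seq_A k (Suc p - k)"
proof -
  have "n < seq_A k n"
  proof (induction n)
    case (Suc n)
    have "seq_A k (Suc n) > seq_A k n"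
      by (simp add: seq_A_less_iff[OF assms(1)])
    with Suc show ?case by linarith
  qed simp
  define q where "q = (LEAST q. n < seq_A k q)"
  have q: "n < seq_A k q"
    unfolding q_def using \<open>n < seq_A k n\<close> by (rule LeastI)
  \<comment> \<open>\<open>A 0 = 1\<close> and \<open>n > 0\<close> rule out
    \<open>q = 0\<close>.\<close>
  then obtain p where p: "q = Suc p"
    using assms(2) by (cases q) auto
  have "\<not> n < seq_A k p"
    using not_less_Least[of p "\<lambda>q. n < seq_A k q"] p by (simp add: q_def)
  with q p seq_A_Suc[OF assms(1), of p] show thesis
    by (intro that[of p "n - seq_A k p"]) auto
qed

lemma seq_A_induct [consumes 1, case_names zero add]:
  assumes k: "k \<ge> 1" and zero: "P 0"
    and add: "\<And>p m. m < seq_A k (Suc p - k) \<Longrightarrow> P m \<Longrightarrow> P (seq_A k p + m)"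
  shows "P n"
proof (induction n rule: less_induct)
  case (less n)
  show ?case
  proof (cases "n = 0")
    case False
    then obtain p m where "n = seq_A k p + m" "m < seq_A k (Suc p - k)"
      using seq_A_split[OF k] by blast
    with add less seq_A_pos[of k p] show ?thesis by simp
  qed (simp add: zero)
qed

section \<open>Sparse decompositions: uniqueness and existence\<close>

text \<open>Any \<open>q\<close> in \<open>D\<close> has \<open>A q \<le> m < A (p + 1 - k)\<close>,
  so monotonicity puts it at least \<open>k\<close> below \<open>p\<close>.\<close>

lemma is_decomp_insert:
  assumes k: "k \<ge> 1" and m: "m < seq_A k (Suc p - k)" and D: "is_decomp k m D"
  shows "is_decomp k (seq_A k p + m) (insert p D)" "p \<notin> D"
proof -
  have sparse: "q + k \<le> p" if "q \<in> D" for q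
  proof -
    have "seq_A k q \<le> m"
      using D that by (auto simp: is_decomp_def intro: member_le_sum)
    then have "q < Suc p - k"
      using m seq_A_less_iff[OF k] by (metis le_less_trans)
    then show ?thesis by simp
  qed
  then show "p \<notin> D" using k by fastforce
  with D show "is_decomp k (seq_A k p + m) (insert p D)"
    unfolding is_decomp_def by (auto dest!: sparse)
qed

lemma is_decomp_remove:
  assumes "is_decomp k n D" "p \<in> D"
  shows "is_decomp k (n - seq_A k p) (D - {p})" "seq_A k p \<le> n"
  using assms by (auto simp: is_decomp_def sum_diff1_nat intro: member_le_sum)

text \<open>If \<open>r - 1\<close> lies in \<open>D\<close>, all other elements are below
  \<open>r - k\<close>, so by induction the total is less than
  \<open>A (r - 1) + A (r - k) = A r\<close>.\<close>

lemma is_decomp_less: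
  assumes k: "k \<ge> 1" and "is_decomp k n D" "\<forall>p\<in>D. p < r"
  shows "n < seq_A k r"
  using assms(2,3)
proof (induction r arbitrary: n D rule: less_induct)
  case (less r)
  show ?case
  proof (cases r)
    case 0
    then show ?thesis using less.prems by (auto simp: is_decomp_def)
  next
    case (Suc s)
    show ?thesis
    proof (cases "s \<in> D")
      case True
      have "q < r - k" if "q \<in> D - {s}" for q
      proof -
        have "q < r" "\<bar>int q - int s\<bar> \<ge> int k" "q \<noteq> s"
          using less.prems True that by (auto simp: is_decomp_def)
        then show ?thesis using Suc by linarith
      qed
      then have "n - seq_A k s < seq_A k (r - k)"
        using less.IH[of "r - k"] is_decomp_remove(1)[OF less.prems(1) True] k Suc by simp
      then show ?thesis using Suc seq_A_Suc[OF k, of s] by simp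
    next
      case False
      then have "\<forall>p\<in>D. p < s" using less.prems Suc less_antisym by blast
      then have "n < seq_A k s" using less Suc by blast
      then show ?thesis using Suc seq_A_Suc[OF k, of s] by simp
    qed
  qed
qed

text \<open>The largest element is the only \<open>p\<close> with
  \<open>A p \<le> n < A (p + 1)\<close>; removing it leaves decompositions of a smaller
  number.\<close>

lemma is_decomp_unique:
  assumes k: "k \<ge> 1" and "is_decomp k n D" "is_decomp k n E"
  shows "D = E"
  using assms(2,3)
proof (induction n arbitrary: D E rule: less_induct)
  case (less n)
  show ?case
  proof (cases "n = 0")
    case True
    have "B = {}" if "is_decomp k 0 B" for B
      using that is_decomp_remove(2) seq_A_pos[of k] by (metis all_not_in_conv leD)
    then show ?thesis using True less.prems by blast
  next
    case False
    have max: "finite B" "Max B \<in> B" "seq_A k (Max B) \<le> n" "n < seq_A k (Suc (Max B))"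
      if "is_decomp k n B" for B
    proof -
      show fin: "finite B" using that by (simp add: is_decomp_def)
      have "B \<noteq> {}" using that False by (auto simp: is_decomp_def)
      with fin show "Max B \<in> B" by simp
      then show "seq_A k (Max B) \<le> n" using is_decomp_remove(2)[OF that] by blast
      show "n < seq_A k (Suc (Max B))"
        using is_decomp_less[OF k that] fin by (simp add: less_Suc_eq_le)
    qed
    have le: "Max B \<le> Max C" if "is_decomp k n B" "is_decomp k n C" for B C
      using max(3)[OF that(1)] max(4)[OF that(2)] seq_A_less_iff[OF k] by (metis le_less_trans less_Suc_eq_le)
    have eq: "Max D = Max E"
      using le less.prems by (simp add: antisym)
    have "D - {Max D} = E - {Max D}"
      using less.IH[of "n - seq_A k (Max D)"] is_decomp_remove(1)[OF less.prems(1) max(2)[OF less.prems(1)]]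
        is_decomp_remove(1)[OF less.prems(2) max(2)[OF less.prems(2)]] seq_A_pos[of k] False eq
      by simp
    then show ?thesis using max(2)[OF less.prems(1)] max(2)[OF less.prems(2)] eq by (metis insert_Diff)
  qed
qed

lemma decomp_eqI: "k \<ge> 1 \<Longrightarrow> is_decomp k n D \<Longrightarrow> decomp k n = D"
  unfolding decomp_def by (rule the_equality) (use is_decomp_unique in metis)+

lemma is_decomp_0: "is_decomp k 0 {}"
  by (simp add: is_decomp_def)

lemma is_decomp_decomp:
  assumes "k \<ge> 1"
  shows "is_decomp k n (decomp k n)"
  using assms
proof (induction n rule: seq_A_induct)
  case zero
  then show ?case using decomp_eqI[OF assms is_decomp_0] is_decomp_0 by simp
next
  case (add p m)
  show ?case
    using is_decomp_insert(1)[OF assms add] decomp_eqI[OF assms] by metis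
qed

section \<open>Shifted sums and the iterates of the shift by one\<close>

text \<open>The case \<open>q = 1\<close> is the function \<open>f\<close> that turns out to be
  \<open>hof_F k\<close>.\<close>

definition shift_sum :: "nat \<Rightarrow> nat \<Rightarrow> nat \<Rightarrow> nat" where
  "shift_sum k q n = (\<Sum>p\<in>decomp k n. seq_A k (p - q))"

context
  fixes k :: nat
  assumes k: "k \<ge> 1"
begin

lemma shift_sum_0 [simp]: "shift_sum k q 0 = 0"
  by (simp add: shift_sum_def decomp_eqI[OF k is_decomp_0])

lemma shift_sum_add:
  assumes "m < seq_A k (Suc p - k)"
  shows "shift_sum k q (seq_A k p + m) = seq_A k (p - q) + shift_sum k q m"
proof -
  note D = is_decomp_insert[OF k assms is_decomp_decomp[OF k]]
  have "finite (decomp k m)"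
    using is_decomp_decomp[OF k] by (simp add: is_decomp_def)
  with D(2) show ?thesis
    by (simp add: shift_sum_def decomp_eqI[OF k D(1)])
qed

lemma shift_sum_seq_A: "shift_sum k q (seq_A k p) = seq_A k (p - q)"
  using shift_sum_add[of 0 p q] seq_A_pos[of k] by simp

text \<open>At equality the argument is \<open>A (p + 1)\<close>, which \<open>f\<close> sends to
  \<open>A p = A (p - 1) + A (p - k)\<close>. For \<open>p = 0\<close> this breaks down:
  \<open>f 2 = 1\<close>, while \<open>A 0 + f 1 = 2\<close>.\<close>

lemma shift_sum_1_add_le:
  assumes "m \<le> seq_A k (Suc p - k)" "p \<ge> 1"
  shows "shift_sum k 1 (seq_A k p + m) = seq_A k (p - 1) + shift_sum k 1 m"
proof (cases "m = seq_A k (Suc p - k)")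
  case True
  then have "seq_A k p + m = seq_A k (Suc p)"
    by (simp add: seq_A_Suc[OF k])
  then show ?thesis
    using True assms(2) seq_A_rec[OF k assms(2)] by (simp add: shift_sum_seq_A)
next
  case False
  then show ?thesis using assms by (simp add: shift_sum_add)
qed

text \<open>If the remainder \<open>m\<close> is nonzero, then \<open>p < r\<close>, and induction
  on \<open>m\<close> gives \<open>f n \<le> A (p - 1) + A (p - k) = A p\<close>. A single term
  \<open>A p\<close> may have \<open>p = r\<close>, hence the separate case.\<close>

lemma shift_sum_1_le:
  "n \<le> seq_A k r \<Longrightarrow> shift_sum k 1 n \<le> seq_A k (r - 1)"
  using k
proof (induction n arbitrary: r rule: seq_A_induct)
  case zero
  then show ?case by simp
next
  case (add p m)
  show ?case
  proof (cases "m = 0 \<or> p = 0")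
    case True
    \<comment> \<open>\<open>p = 0\<close> forces \<open>m < A 0 = 1\<close>.\<close>
    then have "m = 0" using add.hyps k by auto
    then have "p \<le> r" using add.prems seq_A_le_iff[OF k] by simp
    then show ?thesis
      using \<open>m = 0\<close> by (simp add: shift_sum_seq_A seq_A_le_iff[OF k])
  next
    case False
    then have "seq_A k p < seq_A k r" using add.prems by simp
    then have "p \<le> r - 1" using seq_A_less_iff[OF k] by simp
    have "shift_sum k 1 m \<le> seq_A k (p - k)"
      using add.IH[of "Suc p - k"] add.hyps by simp
    then have "shift_sum k 1 (seq_A k p + m) \<le> seq_A k p"
      using seq_A_rec[OF k, of p] False unfolding shift_sum_add[OF add.hyps] by simp
    also have "\<dots> \<le> seq_A k (r - 1)"
      using \<open>p \<le> r - 1\<close> by (simp add: seq_A_le_iff[OF k])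
    finally show ?thesis .
  qed
qed

lemma funpow_shift_sum_1_le:
  "n \<le> seq_A k r \<Longrightarrow> (shift_sum k 1 ^^ j) n \<le> seq_A k (r - j)"
  by (induction j) (use shift_sum_1_le in fastforce)+

text \<open>The bound on the remainder moves down along with the leading index. Only its non-strict
  form is propagated, so each step relies on additivity in the boundary case.\<close>

lemma funpow_shift_sum_1_add:
  assumes "m < seq_A k (Suc p - k)" "j \<le> k"
  shows "(shift_sum k 1 ^^ j) (seq_A k p + m) = seq_A k (p - j) + (shift_sum k 1 ^^ j) m"
proof (cases "p < k")
  case True
  then have m: "m = 0" using assms by simp
  have "(shift_sum k 1 ^^ j) 0 = 0"
    by (induction j) auto
  moreover have "(shift_sum k 1 ^^ j) (seq_A k p) = seq_A k (p - j)"
    by (induction j) (simp_all add: shift_sum_seq_A)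
  ultimately show ?thesis using m by simp
next
  case False
  show ?thesis
    using assms(2)
  proof (induction j)
    case (Suc j)
    have "(shift_sum k 1 ^^ j) m \<le> seq_A k (Suc p - k - j)"
      using assms(1) by (intro funpow_shift_sum_1_le) simp
    also have "Suc p - k - j = Suc (p - j) - k"
      using False Suc.prems by simp
    \<comment> \<open>\<open>j < k \<le> p\<close> gives \<open>p - j \<ge> 1\<close>, as the
      boundary case requires.\<close>
    finally show ?case
      using Suc False shift_sum_1_add_le[of _ "p - j"] by simp
  qed simp
qed

lemma funpow_shift_sum_1:
  assumes "q \<le> k"
  shows "(shift_sum k 1 ^^ q) n = shift_sum k q n"
  using k
proof (induction n rule: seq_A_induct)
  case zero
  show ?case by (induction q) auto
next
  case (add p m)
  then show ?case
    by (simp add: funpow_shift_sum_1_add[OF _ assms] shift_sum_add del: One_nat_def)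
qed

section \<open>The recursion satisfied by the shifts\<close>

text \<open>\<open>A p - 1 = A (p - 1) + (A (p - k) - 1)\<close> is again a greedy splitting, so the
  claim descends from \<open>p\<close> to \<open>p - k\<close>; for \<open>p \<le> k\<close> the
  remainder is 0.\<close>

lemma shift_sum_pred_seq_A: "p \<ge> 1 \<Longrightarrow> shift_sum k k (seq_A k p - 1) = seq_A k (p - k)"
proof (induction p rule: less_induct)
  case (less p)
  have pos: "seq_A k (p - k) > 0" by (rule seq_A_pos)
  have "seq_A k p - 1 = seq_A k (p - 1) + (seq_A k (p - k) - 1)"
    using seq_A_rec[OF k less.prems] pos by simp
  moreover have "seq_A k (p - k) - 1 < seq_A k (Suc (p - 1) - k)"
    using less.prems pos by simp
  ultimately have eq: "shift_sum k k (seq_A k p - 1)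
      = seq_A k (p - 1 - k) + shift_sum k k (seq_A k (p - k) - 1)"
    by (simp only: shift_sum_add)
  show ?case
  proof (cases "p \<le> k")
    case True
    then show ?thesis using eq by simp
  next
    case False
    then show ?thesis
      using eq less.IH[of "p - k"] seq_A_rec[OF k, of "p - k"] k by (simp add: diff_diff_add add.commute)
  qed
qed

text \<open>The two shifts of a leading \<open>A p\<close> add up to
  \<open>A (p - 1) + A (p - k) = A p\<close>. For \<open>m > 0\<close> the predecessor keeps this
  leading term; for \<open>m = 0\<close> and \<open>p \<ge> 1\<close> the borrow is resolved by
  \<open>shift_sum_pred_seq_A\<close>.\<close>

lemma shift_sum_1_rec:
  "n \<ge> 1 \<Longrightarrow> shift_sum k 1 n + shift_sum k k (n - 1) = n"
  using k
proof (induction n rule: seq_A_induct)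
  case zero
  then show ?case by simp
next
  case (add p m)
  show ?case
  proof (cases "m = 0")
    case True
    show ?thesis
    proof (cases "p = 0")
      case True
      then show ?thesis using \<open>m = 0\<close> shift_sum_seq_A[of 1 0] by simp
    next
      case False
      then show ?thesis
        using True seq_A_rec[OF k, of p] shift_sum_pred_seq_A[of p] shift_sum_seq_A[of 1 p] by simp
    qed
  next
    case False
    then have p: "p \<ge> 1" using add.hyps k by (cases p) auto
    have "seq_A k p + m - 1 = seq_A k p + (m - 1)" using False by simp
    moreover have "m - 1 < seq_A k (Suc p - k)" using add.hyps by simp
    ultimately have "shift_sum k k (seq_A k p + m - 1) = seq_A k (p - k) + shift_sum k k (m - 1)"
      by (simp only: shift_sum_add)
    then show ?thesis
      using add.IH False seq_A_rec[OF k p] unfolding shift_sum_add[OF add.hyps] by simp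
  qed
qed

lemma hof_F_eq_shift_sum: "hof_F k n = shift_sum k 1 n"
proof (induction n rule: less_induct)
  case (less n)
  show ?case
  proof (cases "n = 0")
    case True
    then show ?thesis by (simp add: hof_F_0)
  next
    case False
    \<comment> \<open>All iterates from \<open>n - 1\<close> stay below \<open>n\<close>, so the
      induction hypothesis applies to each.\<close>
    have "(hof_F k ^^ j) (n - 1) = (shift_sum k 1 ^^ j) (n - 1)" for j
    proof (induction j)
      case (Suc j)
      have "(hof_F k ^^ j) (n - 1) < n"
        using hof_F_funpow_le[of j k "n - 1"] False by simp
      from less[OF this] Suc show ?case by simp
    qed simp
    then have "hof_F k n = n - shift_sum k k (n - 1)"
      using hof_F_rec[of n k] False by (simp add: funpow_shift_sum_1 del: One_nat_def)
    then show ?thesis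
      using shift_sum_1_rec[of n] False by simp
  qed
qed

end

theorem theorem4p10:
  fixes k n :: nat
  assumes "k \<ge> 1"
  shows "hof_F k n = (\<Sum>p\<in>decomp k n. seq_A k (p - 1)) \<and>
         (\<forall>q. 1 \<le> q \<and> q \<le> k \<longrightarrow> (hof_F k ^^ q) n = (\<Sum>p\<in>decomp k n. seq_A k (p - q)))"
proof -
  have "hof_F k = shift_sum k 1"
    using hof_F_eq_shift_sum[OF assms] by blast
  then show ?thesis
    using funpow_shift_sum_1[OF assms] by (simp add: shift_sum_def)
qed

end
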